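(* Let $H$ be a graph without isolated vertices. Then $$(1-o(1))\left(\frac{m}{|E(H)|}\right)^{\alpha_f(H)} \le \rho(H,m) \le \frac{(2m)^{\alpha_f(H)}}{|\mathrm{Aut}(H)|},$$ where the upper bound holds for every positive integer $m$, and in the lower bound $o(1)$ denotes a quantity tending to $0$ as $m\to\infty$ with $H$ fixed.
   Context: Graphs are finite, simple, undirected, with nonempty vertex set. For graphs $G$ and $H$, $c(G,H)$ is the number of induced copies of $H$ in $G$, i.e. the number of subsets $S\subseteq V(G)$ such that the induced subgraph $G[S]$ is isomorphic to $H$. For a positive integer $m$, $\rho(H,m)=\max\{c(G,H) : G \text{ a graph with } |E(G)|=m\}$ (the number of vertices of $G$ is not restricted). The fractional independence number $\alpha_f(H)$ is the maximum of $\sum_{v\in V(H)}\omega(v)$ over all functions $\omega:V(H)\to[0,1]$ satisfying $\omega(u)+\omega(v)\le 1$ for every edge $uv\in E(H)$. $\mathrm{Aut}(H)$ is the automorphism group of $H$. *)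

theory Defs
  imports Complex_Main "HOL-Combinatorics.Permutations"
begin

record 'a ugraph =
  verts :: "'a set"
  edges :: "'a set set"

definition simple_graph :: "'a ugraph \<Rightarrow> bool" where
  "simple_graph G \<longleftrightarrow>
     finite (verts G) \<and> verts G \<noteq> {} \<and> (\<forall>e\<in>edges G. e \<subseteq> verts G \<and> card e = 2)"

definition no_isolated_vertices :: "'a ugraph \<Rightarrow> bool" where
  "no_isolated_vertices G \<longleftrightarrow> (\<forall>v\<in>verts G. \<exists>e\<in>edges G. v \<in> e)"

definition induced_subgraph :: "'a ugraph \<Rightarrow> 'a set \<Rightarrow> 'a ugraph" where
  "induced_subgraph G S = \<lparr>verts = S, edges = {e \<in> edges G. e \<subseteq> S}\<rparr>"

definition graph_iso :: "('a \<Rightarrow> 'b) \<Rightarrow> 'a ugraph \<Rightarrow> 'b ugraph \<Rightarrow> bool" where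
  "graph_iso f G H \<longleftrightarrow>
     bij_betw f (verts G) (verts H) \<and>
     (\<forall>u\<in>verts G. \<forall>v\<in>verts G. {u, v} \<in> edges G \<longleftrightarrow> {f u, f v} \<in> edges H)"

definition isomorphic :: "'a ugraph \<Rightarrow> 'b ugraph \<Rightarrow> bool" where
  "isomorphic G H \<longleftrightarrow> (\<exists>f. graph_iso f G H)"

(* Using permutes makes an automorphism the identity outside the vertex set, so that
   automorphisms are not counted several times for their values there. *)
definition Aut :: "'a ugraph \<Rightarrow> ('a \<Rightarrow> 'a) set" where
  "Aut H = {f. f permutes verts H \<and> graph_iso f H H}"

definition induced_copies :: "'b ugraph \<Rightarrow> 'a ugraph \<Rightarrow> nat" where
  "induced_copies G H = card {S. S \<subseteq> verts G \<and> isomorphic (induced_subgraph G S) H}"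

(* The host graphs G range over graphs on vertices of type nat; every finite graph is isomorphic
   to one of these, and induced_copies is invariant under isomorphism of G. For m > 0 and a graph
   H without isolated vertices the set is finite and nonempty, so that Max is meaningful. *)
definition rho :: "'a ugraph \<Rightarrow> nat \<Rightarrow> nat" where
  "rho H m = Max {induced_copies G H | G :: nat ugraph. simple_graph G \<and> card (edges G) = m}"

definition fractional_independent :: "'a ugraph \<Rightarrow> ('a \<Rightarrow> real) \<Rightarrow> bool" where
  "fractional_independent H w \<longleftrightarrow>
     (\<forall>v\<in>verts H. 0 \<le> w v \<and> w v \<le> 1) \<and>
     (\<forall>u\<in>verts H. \<forall>v\<in>verts H. {u, v} \<in> edges H \<longrightarrow> w u + w v \<le> 1)"

(* The maximum is attained: the feasible weightings of a finite graph form a nonempty compact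
   polytope. *)
definition fractional_independence_number :: "'a ugraph \<Rightarrow> real" where
  "fractional_independence_number H =
     (GREATEST a. \<exists>w. fractional_independent H w \<and> a = (\<Sum>v\<in>verts H. w v))"

end

(* Consider the bipartite double cover of H, whose edges are the ordered pairs of adjacent vertices.
   Koenig's theorem yields an independent pair (A, B) and a set C of ordered edges covering both
   sides with card C <= card A + card B. The half-integral weighting (1_A + 1_B) / 2 is then optimal,
   and alpha_f(H) = card C / 2.

   Upper bound: every vertex of H lies in at least two members of C, so eliminating the vertices one
   after another by Cauchy-Schwarz bounds the number of maps V(H) -> V(G) that respect C by
   (2m)^(card C / 2). Each induced copy of H accounts for card (Aut H) of these maps.

   Lower bound: for an optimal weighting w, replace each vertex v of H by an independent set of size
   floor ((m / card E(H)) powr w v). Since w u + w v <= 1 on edges, the blow-up has at most m edges,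
   and each transversal of it induces a copy of H. *)
theory Submission
  imports Defs "HOL-Analysis.L2_Norm" "HOL-Library.FuncSet" "HOL-Real_Asymp.Real_Asymp"
begin

section \<open>Koenig's theorem for bipartite graphs\<close>

text \<open>Lovasz's argument: independent sets that become too large when either of two edges at
  \<open>x\<close> is deleted can be uncrossed into two independent sets, one of which avoids \<open>x\<close>.\<close>

lemma critical_edges_no_common_source:
  fixes R :: "('a \<times> 'b) set"
  assumes fin: "finite X" "finite Y"
    and bound: "\<And>A B. A \<subseteq> X \<Longrightarrow> B \<subseteq> Y \<Longrightarrow> (A \<times> B) \<inter> R = {} \<Longrightarrow> card A + card B \<le> k"
    and crit: "\<And>e. e \<in> R \<Longrightarrow>
      \<exists>A B. A \<subseteq> X \<and> B \<subseteq> Y \<and> (A \<times> B) \<inter> (R - {e}) = {} \<and> k < card A + card B"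
    and e: "(x, y) \<in> R" "(x, z) \<in> R"
  shows "y = z"
proof (rule ccontr)
  assume "y \<noteq> z"
  from crit[OF e(1)] obtain A1 B1 where 1: "A1 \<subseteq> X" "B1 \<subseteq> Y"
    "(A1 \<times> B1) \<inter> (R - {(x,y)}) = {}" "k < card A1 + card B1" by blast
  from crit[OF e(2)] obtain A2 B2 where 2: "A2 \<subseteq> X" "B2 \<subseteq> Y"
    "(A2 \<times> B2) \<inter> (R - {(x,z)}) = {}" "k < card A2 + card B2" by blast
  \<comment> \<open>A pair larger than \<open>k\<close> must meet \<open>R\<close>, and only the
    deleted edge can do so; hence its ends lie in the pair.\<close>
  have "(A1 \<times> B1) \<inter> R \<noteq> {}" "(A2 \<times> B2) \<inter> R \<noteq> {}"
    using bound[of A1 B1] bound[of A2 B2] 1 2 by linarith+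
  then have in1: "x \<in> A1" "y \<in> B1" and in2: "x \<in> A2" "z \<in> B2" using 1(3) 2(3) by blast+
  have out: "y \<notin> B2" "z \<notin> B1" using 1(3) 2(3) in1 in2 e \<open>y \<noteq> z\<close> by blast+
  have f: "finite A1" "finite A2" "finite B1" "finite B2"
    using 1 2 fin by (meson finite_subset)+
  \<comment> \<open>Uncrossing: the deleted edges end in \<open>y\<close> and \<open>z\<close>,
    neither of which is in \<open>B1 \<inter> B2\<close>, and start in \<open>x\<close>, which the
    second new pair drops. Dropping \<open>x\<close> costs one, but the two original sums exceed
    \<open>2 * k\<close> by at least two.\<close>
  have "card (A1 \<union> A2) + card (B1 \<inter> B2) \<le> k"
    by (rule bound) (use 1 2 out in blast)+
  moreover have "card ((A1 \<inter> A2) - {x}) + card (B1 \<union> B2) \<le> k"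
    by (rule bound) (use 1 2 in blast)+
  moreover have "card (A1 \<inter> A2) = Suc (card ((A1 \<inter> A2) - {x}))"
    using in1 in2 f by (metis IntI card_Suc_Diff1 finite_Int)
  moreover have "card A1 + card A2 = card (A1 \<union> A2) + card (A1 \<inter> A2)"
    "card B1 + card B2 = card (B1 \<union> B2) + card (B1 \<inter> B2)"
    using f card_Un_Int by blast+
  ultimately show False using 1(4) 2(4) by linarith
qed

text \<open>Deleting edges as long as the bound \<open>k\<close> on independent pairs survives ends
  with a relation whose edges are all critical, and such a relation is itself a matching.\<close>

lemma Koenig_matching:
  fixes R :: "('a \<times> 'b) set"
  assumes "finite X" "finite Y" "R \<subseteq> X \<times> Y"
    and "\<And>A B. A \<subseteq> X \<Longrightarrow> B \<subseteq> Y \<Longrightarrow> (A \<times> B) \<inter> R = {} \<Longrightarrow> card A + card B \<le> k"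
  shows "\<exists>M\<subseteq>R. single_valued M \<and> single_valued (M\<inverse>) \<and> card X + card Y \<le> card M + k"
proof -
  have "finite R" using assms(1-3) by (meson finite_SigmaI finite_subset)
  then show ?thesis using assms(3,4)
  proof (induction R rule: finite_psubset_induct)
    case (psubset R)
    show ?case
    proof (cases "\<exists>e\<in>R. \<forall>A B. A \<subseteq> X \<longrightarrow> B \<subseteq> Y \<longrightarrow> (A \<times> B) \<inter> (R - {e}) = {} \<longrightarrow> card A + card B \<le> k")
      case True
      then obtain e where e: "e \<in> R"
        "\<forall>A B. A \<subseteq> X \<longrightarrow> B \<subseteq> Y \<longrightarrow> (A \<times> B) \<inter> (R - {e}) = {} \<longrightarrow> card A + card B \<le> k" by blast
      have "\<exists>M\<subseteq>R - {e}. single_valued M \<and> single_valued (M\<inverse>) \<and> card X + card Y \<le> card M + k"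
        by (rule psubset.IH) (use e psubset.prems(1) in blast)+
      then show ?thesis by blast
    next
      case False
      then have crit: "\<exists>A B. A \<subseteq> X \<and> B \<subseteq> Y \<and> (A \<times> B) \<inter> (R - {e}) = {} \<and> k < card A + card B"
        if "e \<in> R" for e using that by (meson not_le)
      \<comment> \<open>Criticality is symmetric in the two sides, so the previous lemma applies to
        the converse as well.\<close>
      have crit': "\<exists>A B. A \<subseteq> Y \<and> B \<subseteq> X \<and> (A \<times> B) \<inter> (R\<inverse> - {e}) = {} \<and> k < card A + card B"
        if "e \<in> R\<inverse>" for e
      proof -
        from that obtain x y where xy: "e = (y, x)" "(x, y) \<in> R" by blast
        from crit[OF xy(2)] obtain A B where "A \<subseteq> X" "B \<subseteq> Y" "(A \<times> B) \<inter> (R - {(x,y)}) = {}"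
          "k < card A + card B" by blast
        then show ?thesis using xy by (intro exI[of _ B] exI[of _ A]) auto
      qed
      have sv: "single_valued R"
        unfolding single_valued_def
        using critical_edges_no_common_source[OF assms(1,2) psubset.prems(2) crit] by blast
      have "card A + card B \<le> k" if "A \<subseteq> Y" "B \<subseteq> X" "(A \<times> B) \<inter> R\<inverse> = {}" for A B
        using psubset.prems(2)[of B A] that by (subst add.commute) blast
      then have sv': "single_valued (R\<inverse>)"
        unfolding single_valued_def
        using critical_edges_no_common_source[OF assms(2,1) _ crit'] by blast
      \<comment> \<open>No edge reaches an unmatched vertex of \<open>Y\<close>, so this pair is
        independent.\<close>
      have "card X + card (Y - Range R) \<le> k"
        by (rule psubset.prems(2)) auto
      moreover have "inj_on snd R" using sv' by (auto simp: inj_on_def single_valued_def)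
      then have "card (Range R) = card R" by (simp add: Range_snd card_image)
      moreover have "card (Y - Range R) = card Y - card (Range R)" "card (Range R) \<le> card Y"
        using psubset.prems(1) assms(2)
        by (auto intro!: card_Diff_subset card_mono dest: finite_subset intro: finite_subset[of _ Y])
      ultimately have "card X + card Y \<le> card R + k" by linarith
      then show ?thesis using sv sv' by blast
    qed
  qed
qed

text \<open>Gallai's argument: take a largest independent pair, a matching \<open>M\<close> of the
  corresponding size, and one more edge for each unmatched vertex. This makes at most
  \<open>card X + card Y - card M\<close> edges.\<close>

lemma Koenig_edge_cover:
  fixes R :: "('a \<times> 'b) set"
  assumes fin: "finite X" "finite Y" and R: "R \<subseteq> X \<times> Y" "Domain R = X" "Range R = Y"
  obtains A B C where "A \<subseteq> X" "B \<subseteq> Y" "(A \<times> B) \<inter> R = {}"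
    "C \<subseteq> R" "Domain C = X" "Range C = Y" "card C \<le> card A + card B"
proof -
  define P where "P = {(A, B). A \<subseteq> X \<and> B \<subseteq> Y \<and> (A \<times> B) \<inter> R = {}}"
  define F where "F = (\<lambda>(A :: 'a set, B :: 'b set). card A + card B)"
  have "P \<subseteq> Pow X \<times> Pow Y" by (auto simp: P_def)
  then have "finite P" using fin by (meson finite_Pow_iff finite_SigmaI finite_subset)
  moreover have "({}, {}) \<in> P" by (simp add: P_def)
  ultimately have "Max (F ` P) \<in> F ` P" by (intro Max_in) auto
  then obtain p where p: "p \<in> P" "F p = Max (F ` P)" by auto
  have max: "F q \<le> F p" if "q \<in> P" for q
    using that \<open>finite P\<close> by (simp add: p(2))
  obtain A B where AB: "p = (A, B)" by fastforce
  have "\<exists>M\<subseteq>R. single_valued M \<and> single_valued (M\<inverse>) \<and> card X + card Y \<le> card M + (card A + card B)"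
    using max by (intro Koenig_matching fin R) (auto simp: P_def F_def AB)
  then obtain M where M: "M \<subseteq> R" "single_valued M" "single_valued (M\<inverse>)"
    "card X + card Y \<le> card M + (card A + card B)" by blast
  have "\<forall>x\<in>X. \<exists>y. (x, y) \<in> R" "\<forall>y\<in>Y. \<exists>x. (x, y) \<in> R" using R by blast+
  then obtain f g where f: "\<And>x. x \<in> X \<Longrightarrow> (x, f x) \<in> R" and g: "\<And>y. y \<in> Y \<Longrightarrow> (g y, y) \<in> R"
    by metis
  define C where "C = M \<union> (\<lambda>x. (x, f x)) ` (X - Domain M) \<union> (\<lambda>y. (g y, y)) ` (Y - Range M)"
  have CR: "C \<subseteq> R" using M(1) f g by (auto simp: C_def)
  have dom: "Domain C = X" and ran: "Range C = Y"
    using CR R unfolding C_def by blast+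
  have "inj_on fst M" "inj_on snd M"
    using M(2,3) by (auto simp: inj_on_def single_valued_def)
  then have "card (Domain M) = card M" "card (Range M) = card M"
    by (simp_all add: Range_snd Domain_fst card_image)
  moreover have "Domain M \<subseteq> X" "Range M \<subseteq> Y" using M(1) R by blast+
  ultimately have *: "card (X - Domain M) = card X - card M" "card (Y - Range M) = card Y - card M"
    "card M \<le> card X" "card M \<le> card Y"
    using fin by (metis card_Diff_subset finite_subset card_mono)+
  have "card C \<le> card M + card (X - Domain M) + card (Y - Range M)"
    unfolding C_def using fin
    by (meson add_mono card_Un_le card_image_le finite_Diff order_refl order_trans)
  then have "card C \<le> card A + card B" using * M(4) by linarith
  moreover have "A \<subseteq> X" "B \<subseteq> Y" "(A \<times> B) \<inter> R = {}" using p(1) by (auto simp: P_def AB)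
  ultimately show thesis using that CR dom ran by blast
qed

section \<open>A Finner-type inequality\<close>

text \<open>Cauchy-Schwarz handles two of the factors. Every other factor is bounded pointwise by
  its own L2 norm, because the sum of squares contains the square of each value, and so leaves the
  sum as a constant.\<close>

lemma sum_prod_le_prod_L2_set:
  fixes g :: "'c \<Rightarrow> 'b \<Rightarrow> real"
  assumes fin: "finite X" and D: "2 \<le> card D" and nn: "\<And>c x. c \<in> D \<Longrightarrow> 0 \<le> g c x"
  shows "(\<Sum>x\<in>X. \<Prod>c\<in>D. g c x) \<le> (\<Prod>c\<in>D. L2_set (g c) X)"
proof -
  have finD: "finite D" using D card.infinite by fastforce
  obtain a where a: "a \<in> D" using D by fastforce
  have "D - {a} \<noteq> {}" using D finD a by (metis card_1_singleton_iff card_Diff_singleton card.empty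
        diff_is_0_eq numeral_2_eq_2 not_less_eq_eq le_refl One_nat_def)
  then obtain b where b: "b \<in> D" "b \<noteq> a" by blast
  define D' where "D' = D - {a} - {b}"
  have split: "prod F D = F a * F b * prod F D'" for F :: "'c \<Rightarrow> real"
    unfolding D'_def using finD a b by (simp add: prod.remove[of D a] prod.remove[of "D-{a}" b] mult.assoc)
  define K where "K = (\<Prod>c\<in>D'. L2_set (g c) X)"
  have K0: "0 \<le> K" unfolding K_def by (simp add: prod_nonneg)
  have "(\<Sum>x\<in>X. \<Prod>c\<in>D. g c x) \<le> (\<Sum>x\<in>X. \<bar>g a x\<bar> * \<bar>g b x\<bar> * K)"
    unfolding split K_def using nn a b fin
    by (intro sum_mono mult_mono prod_mono) (auto simp: D'_def intro!: member_le_L2_set prod_nonneg)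
  also have "\<dots> = (\<Sum>x\<in>X. \<bar>g a x\<bar> * \<bar>g b x\<bar>) * K" by (simp add: sum_distrib_right)
  also have "\<dots> \<le> L2_set (g a) X * L2_set (g b) X * K"
    using K0 by (intro mult_right_mono L2_set_mult_ineq)
  also have "\<dots> = (\<Prod>c\<in>D. L2_set (g c) X)" by (simp add: split K_def)
  finally show ?thesis .
qed

lemma sum_PiE_insert:
  assumes "v \<notin> V"
  shows "(\<Sum>h\<in>PiE (insert v V) (\<lambda>_. X). F h) = (\<Sum>h\<in>PiE V (\<lambda>_. X). \<Sum>x\<in>X. F (h(v := x)))"
proof -
  have "(\<Sum>h\<in>PiE (insert v V) (\<lambda>_. X). F h) = (\<Sum>(x, h)\<in>X \<times> PiE V (\<lambda>_. X). F (h(v := x)))"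
    unfolding PiE_insert_eq
    by (subst sum.reindex[OF inj_combinator[OF assms]]) (simp add: case_prod_unfold)
  also have "\<dots> = (\<Sum>h\<in>PiE V (\<lambda>_. X). \<Sum>x\<in>X. F (h(v := x)))"
    by (subst sum.cartesian_product[symmetric]) (rule sum.swap)
  finally show ?thesis .
qed

text \<open>Finner's inequality with all exponents 2. Coordinates are summed out one at a time; with
  the others fixed, at least two factors depend on the current one.\<close>

lemma Finner_inequality_two_cover:
  fixes f :: "'c \<Rightarrow> ('a \<Rightarrow> 'b) \<Rightarrow> real" and S :: "'c \<Rightarrow> 'a set"
  assumes "finite V" "finite X" "finite C"
    and "\<And>c. c \<in> C \<Longrightarrow> S c \<subseteq> V"
    and "\<And>v. v \<in> V \<Longrightarrow> 2 \<le> card {c \<in> C. v \<in> S c}"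
    and "\<And>c p. c \<in> C \<Longrightarrow> 0 \<le> f c p"
  shows "(\<Sum>h\<in>PiE V (\<lambda>_. X). \<Prod>c\<in>C. f c (restrict h (S c)))
           \<le> (\<Prod>c\<in>C. L2_set (f c) (PiE (S c) (\<lambda>_. X)))"
  using assms(1,4-6)
proof (induction V arbitrary: f S rule: finite_induct)
  case empty
  \<comment> \<open>Only the everywhere undefined function remains, so each norm is a single
    nonnegative value.\<close>
  then have S: "S c = {}" if "c \<in> C" for c using that by blast
  have "(\<Prod>c\<in>C. L2_set (f c) (PiE (S c) (\<lambda>_. X))) = (\<Prod>c\<in>C. f c (\<lambda>_. undefined))"
    using S empty by (intro prod.cong) (auto simp: L2_set_def)
  moreover have "(\<Prod>c\<in>C. f c (restrict h (S c))) = (\<Prod>c\<in>C. f c (\<lambda>_. undefined))" for h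
    using S by (intro prod.cong) (auto simp: restrict_def)
  ultimately show ?case by simp
next
  case (insert v V)
  define S' where "S' = (\<lambda>c. S c - {v})"
  \<comment> \<open>A factor that depends on \<open>v\<close> becomes its L2 norm in that
    coordinate, a function of the remaining coordinates of \<open>S c\<close>.\<close>
  define f' where "f' = (\<lambda>c p. if v \<in> S c then L2_set (\<lambda>x. f c (p(v := x))) X else f c p)"
  define D where "D = {c \<in> C. v \<in> S c}"
  have restr_in: "restrict (h(v := x)) (S c) = (restrict h (S' c))(v := x)" if "v \<in> S c" for h c and x :: 'b
    using that by (auto simp: S'_def restrict_def)
  have restr_out: "restrict (h(v := x)) (S c) = restrict h (S' c)" if "v \<notin> S c" for h c and x :: 'b
    using that by (auto simp: S'_def restrict_def)
  have CD: "D \<subseteq> C"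
    using assms(3) by (auto simp: D_def)
  have prod_split: "prod F C = prod F D * prod F (C - D)" for F :: "'c \<Rightarrow> real"
    using prod.subset_diff[OF CD assms(3)] by (simp add: mult.commute)
  have step: "(\<Sum>x\<in>X. \<Prod>c\<in>C. f c (restrict (h(v := x)) (S c))) \<le> (\<Prod>c\<in>C. f' c (restrict h (S' c)))" for h
  proof -
    have "(\<Sum>x\<in>X. \<Prod>c\<in>C. f c (restrict (h(v := x)) (S c)))
      = (\<Sum>x\<in>X. \<Prod>c\<in>D. f c ((restrict h (S' c))(v := x))) * (\<Prod>c\<in>C-D. f c (restrict h (S' c)))"
      unfolding prod_split sum_distrib_right
      by (intro sum.cong arg_cong2[of _ _ _ _ "(*)"] prod.cong) (auto simp: D_def S'_def restr_in restr_out)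
    also have "\<dots> \<le> (\<Prod>c\<in>D. L2_set (\<lambda>x. f c ((restrict h (S' c))(v := x))) X) * (\<Prod>c\<in>C-D. f c (restrict h (S' c)))"
      using insert.prems(2)[of v] insert.prems(3) CD
      by (intro mult_right_mono sum_prod_le_prod_L2_set assms prod_nonneg) (auto simp: D_def)
    also have "\<dots> = (\<Prod>c\<in>C. f' c (restrict h (S' c)))"
      unfolding prod_split by (intro arg_cong2[of _ _ _ _ "(*)"] prod.cong) (auto simp: D_def f'_def)
    finally show ?thesis .
  qed
  \<comment> \<open>Taking the norm first in the coordinate \<open>v\<close> and then in the others
    gives the full norm, so the right-hand side is unchanged.\<close>
  have norm: "L2_set (f' c) (PiE (S' c) (\<lambda>_. X)) = L2_set (f c) (PiE (S c) (\<lambda>_. X))" if "c \<in> C" for c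
  proof (cases "v \<in> S c")
    case True
    then have "S c = insert v (S' c)" "v \<notin> S' c" by (auto simp: S'_def)
    then have "(\<Sum>p\<in>PiE (S c) (\<lambda>_. X). (f c p)\<^sup>2) = (\<Sum>p\<in>PiE (S' c) (\<lambda>_. X). \<Sum>x\<in>X. (f c (p(v := x)))\<^sup>2)"
      by (metis sum_PiE_insert[of v "S' c" "\<lambda>p. (f c p)\<^sup>2" X])
    then show ?thesis using True by (simp add: L2_set_def f'_def sum_nonneg)
  next
    case False
    then show ?thesis by (simp add: f'_def S'_def L2_set_def)
  qed
  have "(\<Sum>h\<in>PiE (insert v V) (\<lambda>_. X). \<Prod>c\<in>C. f c (restrict h (S c)))
      \<le> (\<Sum>h\<in>PiE V (\<lambda>_. X). \<Prod>c\<in>C. f' c (restrict h (S' c)))"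
    unfolding sum_PiE_insert[OF insert.hyps(2)] by (intro sum_mono step)
  also have "\<dots> \<le> (\<Prod>c\<in>C. L2_set (f' c) (PiE (S' c) (\<lambda>_. X)))"
  proof (rule insert.IH)
    show "S' c \<subseteq> V" if "c \<in> C" for c using insert.prems(1)[OF that] by (auto simp: S'_def)
    show "2 \<le> card {c \<in> C. u \<in> S' c}" if "u \<in> V" for u
    proof -
      have "{c \<in> C. u \<in> S' c} = {c \<in> C. u \<in> S c}" using that insert.hyps(2) by (auto simp: S'_def)
      then show ?thesis using insert.prems(2)[of u] that by simp
    qed
    show "0 \<le> f' c p" if "c \<in> C" for c p using insert.prems(3)[OF that] by (auto simp: f'_def)
  qed
  also have "\<dots> = (\<Prod>c\<in>C. L2_set (f c) (PiE (S c) (\<lambda>_. X)))" by (intro prod.cong norm refl)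
  finally show ?case .
qed

section \<open>Fractional independence and the upper bound\<close>

definition adjacency :: "'a ugraph \<Rightarrow> ('a \<times> 'a) set" where
  "adjacency G = {(u, v). {u, v} \<in> edges G}"

lemma adjacency_iff [simp]: "(u, v) \<in> adjacency G \<longleftrightarrow> {u, v} \<in> edges G"
  by (simp add: adjacency_def)

lemma simple_graph_edgeD:
  assumes "simple_graph G" "{u, v} \<in> edges G"
  shows "u \<in> verts G" "v \<in> verts G" "u \<noteq> v"
  using assms by (auto simp: simple_graph_def)

lemma simple_graph_finite_edges: "simple_graph G \<Longrightarrow> finite (edges G)"
  by (rule finite_subset[of _ "Pow (verts G)"]) (auto simp: simple_graph_def)

lemma card_edges_pos:
  assumes "simple_graph H" "no_isolated_vertices H"
  shows "0 < card (edges H)"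
proof -
  obtain v where "v \<in> verts H" using assms(1) unfolding simple_graph_def by blast
  then have "edges H \<noteq> {}" using assms(2) unfolding no_isolated_vertices_def by blast
  then show ?thesis using simple_graph_finite_edges[OF assms(1)] by (simp add: card_gt_0_iff)
qed

lemma edge_obtain:
  assumes "simple_graph G" "e \<in> edges G"
  obtains u v where "e = {u, v}" "u \<noteq> v"
proof -
  have "card e = 2" using assms by (simp add: simple_graph_def)
  then show thesis using that by (auto simp: card_2_iff)
qed

text \<open>Linear programming duality made explicit. Weight 1/2 on each pair of \<open>C\<close> is
  a fractional edge cover, whose total bounds every feasible weighting; the weighting from
  \<open>A\<close> and \<open>B\<close> reaches this total.\<close>

lemma fractional_independence_number_cover:
  assumes H: "simple_graph H" "no_isolated_vertices H"
  obtains w C where "fractional_independent H w"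
    "(\<Sum>v\<in>verts H. w v) = fractional_independence_number H"
    "C \<subseteq> adjacency H" "Domain C = verts H" "Range C = verts H"
    "real (card C) \<le> 2 * fractional_independence_number H"
proof -
  let ?V = "verts H" and ?R = "adjacency H"
  have finV: "finite ?V" using H by (simp add: simple_graph_def)
  have "\<exists>u. {u, v} \<in> edges H" if "v \<in> ?V" for v
  proof -
    from H(2) that obtain e where "e \<in> edges H" "v \<in> e" by (auto simp: no_isolated_vertices_def)
    moreover obtain a b where "e = {a, b}" using edge_obtain[OF H(1) \<open>e \<in> edges H\<close>] by blast
    ultimately consider "{a, b} \<in> edges H" "v = b" | "{b, a} \<in> edges H" "v = a"
      by (auto simp: insert_commute)
    then show ?thesis by cases blast+
  qed
  then have nb: "\<exists>u. {u, v} \<in> edges H" "\<exists>u. {v, u} \<in> edges H" if "v \<in> ?V" for v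
    using that by (metis insert_commute)+
  have "?R \<subseteq> ?V \<times> ?V" using simple_graph_edgeD[OF H(1)] by auto
  moreover have "Domain ?R = ?V" "Range ?R = ?V"
    using nb simple_graph_edgeD[OF H(1)] by (auto simp: Domain_iff Range_iff)
  ultimately obtain A B C where ABC: "A \<subseteq> ?V" "B \<subseteq> ?V" "(A \<times> B) \<inter> ?R = {}"
    "C \<subseteq> ?R" "Domain C = ?V" "Range C = ?V" "card C \<le> card A + card B"
    by (rule Koenig_edge_cover[OF finV finV])
  have finC: "finite C"
    using ABC(4) \<open>?R \<subseteq> ?V \<times> ?V\<close> finV by (meson finite_SigmaI finite_subset)
  define w :: "'a \<Rightarrow> real" where "w = (\<lambda>v. (of_bool (v \<in> A) + of_bool (v \<in> B)) / 2)"
  \<comment> \<open>Used for both orientations of an edge: of the four indicators that make up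
    \<open>w u + w v\<close>, at most two are nonzero.\<close>
  have AB: "\<not> (u \<in> A \<and> v \<in> B)" if "{u, v} \<in> edges H" for u v
    using that ABC(3) by auto
  have w: "fractional_independent H w"
    unfolding fractional_independent_def
  proof (intro conjI ballI impI)
    fix u v assume "{u, v} \<in> edges H"
    with AB[of u v] AB[of v u] show "w u + w v \<le> 1"
      by (auto simp: w_def insert_commute)
  qed (auto simp: w_def)
  have sum_w: "(\<Sum>v\<in>?V. w v) = real (card A + card B) / 2"
  proof -
    have "(\<Sum>v\<in>?V. of_bool (v \<in> A) :: real) = card A" "(\<Sum>v\<in>?V. of_bool (v \<in> B) :: real) = card B"
      using ABC(1,2) finV by (simp_all add: Int_absorb1)
    then show ?thesis by (simp add: w_def sum.distrib flip: sum_divide_distrib)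
  qed
  \<comment> \<open>Weak duality: every vertex is a first and also a second component in
    \<open>C\<close>, and each pair carries weight at most 1.\<close>
  have dual: "(\<Sum>v\<in>?V. \<omega> v) \<le> real (card C) / 2" if \<omega>: "fractional_independent H \<omega>" for \<omega>
  proof -
    have nn: "0 \<le> \<omega> v" if "v \<in> ?V" for v using \<omega> that by (simp add: fractional_independent_def)
    have "(\<Sum>v\<in>?V. \<omega> v) \<le> (\<Sum>c\<in>C. \<omega> (fst c))"
      using sum_image_le[OF finC, of \<omega> fst] nn ABC(5) by (auto simp: Domain_fst o_def)
    moreover have "(\<Sum>v\<in>?V. \<omega> v) \<le> (\<Sum>c\<in>C. \<omega> (snd c))"
      using sum_image_le[OF finC, of \<omega> snd] nn ABC(6) by (auto simp: Range_snd o_def)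
    moreover have "\<omega> (fst c) + \<omega> (snd c) \<le> 1" if "c \<in> C" for c
      using that ABC(4) \<omega> simple_graph_edgeD[OF H(1)]
      by (cases c) (auto simp: fractional_independent_def)
    then have "(\<Sum>c\<in>C. \<omega> (fst c) + \<omega> (snd c)) \<le> real (card C)"
      using sum_mono[of C "\<lambda>c. \<omega> (fst c) + \<omega> (snd c)" "\<lambda>_. 1"] by simp
    ultimately show ?thesis by (simp add: sum.distrib)
  qed
  have "fractional_independence_number H = real (card A + card B) / 2"
    unfolding fractional_independence_number_def
    using w sum_w dual ABC(7) by (intro Greatest_equality) force+
  then show thesis using that[OF w _ ABC(4-6)] sum_w ABC(7) by simp
qed

section \<open>Counting maps that respect an edge cover\<close>

lemma card_adjacency_le:
  assumes "simple_graph G"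
  shows "finite (adjacency G)" "card (adjacency G) \<le> 2 * card (edges G)"
proof -
  have fE: "finite (edges G)" by (rule simple_graph_finite_edges[OF assms])
  have "card {(x, y). {x, y} = e} \<le> 2 \<and> finite {(x, y). {x, y} = e}" if e: "e \<in> edges G" for e
  proof -
    obtain a b where "e = {a, b}" using edge_obtain[OF assms e] by blast
    then have *: "{(x, y). {x, y} = e} \<subseteq> {(a, b), (b, a)}" by (auto simp: doubleton_eq_iff)
    have "card {(a, b), (b, a)} \<le> 2" by (cases "a = b") auto
    then show ?thesis using * card_mono[OF _ *] finite_subset[OF *] by auto
  qed
  moreover have "adjacency G = (\<Union>e\<in>edges G. {(x, y). {x, y} = e})" by auto
  ultimately show "finite (adjacency G)" "card (adjacency G) \<le> 2 * card (edges G)"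
    using fE card_UN_le[OF fE, of "\<lambda>e. {(x, y). {x, y} = e}"]
      sum_bounded_above[of "edges G" "\<lambda>e. card {(x, y). {x, y} = e}" 2]
    by (auto simp: mult.commute intro: order_trans)
qed

text \<open>The condition for a pair in \<open>C\<close> is an indicator depending on two
  coordinates. Its L2 norm is at most the square root of the number of ordered edges of
  \<open>G\<close>, and the two-cover inequality multiplies these norms.\<close>

lemma card_cover_homomorphisms_le:
  fixes C :: "('a \<times> 'a) set" and G :: "'b ugraph"
  assumes G: "simple_graph G" "edges G \<noteq> {}" and V: "finite V"
    and C: "Domain C = V" "Range C = V" "\<And>u v. (u, v) \<in> C \<Longrightarrow> u \<noteq> v"
  shows "real (card {h \<in> PiE V (\<lambda>_. verts G). \<forall>(u, v)\<in>C. (h u, h v) \<in> adjacency G})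
    \<le> (2 * real (card (edges G))) powr (real (card C) / 2)"
proof -
  define m where "m = card (edges G)"
  have "0 < m" using G simple_graph_finite_edges[OF G(1)] by (simp add: m_def card_gt_0_iff)
  have "C \<subseteq> V \<times> V" using C(1,2) by auto
  then have finC: "finite C" using V by (meson finite_SigmaI finite_subset)
  have finG: "finite (verts G)" using G(1) by (simp add: simple_graph_def)
  define S where "S = (\<lambda>c :: 'a \<times> 'a. {fst c, snd c})"
  define f :: "'a \<times> 'a \<Rightarrow> ('a \<Rightarrow> 'b) \<Rightarrow> real"
    where "f = (\<lambda>c p. of_bool ((p (fst c), p (snd c)) \<in> adjacency G))"
  let ?P = "PiE V (\<lambda>_. verts G)"
  have prodf: "(\<Prod>c\<in>C. f c (restrict h (S c))) = of_bool (\<forall>(u, v)\<in>C. (h u, h v) \<in> adjacency G)" for h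
    using finC by (cases "\<forall>(u, v)\<in>C. (h u, h v) \<in> adjacency G")
      (auto simp: f_def S_def prod_zero_iff split_beta intro!: prod.neutral simp del: adjacency_iff)
  have "real (card {h \<in> ?P. \<forall>(u, v)\<in>C. (h u, h v) \<in> adjacency G})
      = (\<Sum>h\<in>?P. \<Prod>c\<in>C. f c (restrict h (S c)))"
    unfolding prodf using V finG by (simp add: finite_PiE Int_def del: adjacency_iff)
  also have "\<dots> \<le> (\<Prod>c\<in>C. L2_set (f c) (PiE (S c) (\<lambda>_. verts G)))"
  proof (rule Finner_inequality_two_cover[OF V finG finC])
    show "S c \<subseteq> V" if "c \<in> C" for c using that \<open>C \<subseteq> V \<times> V\<close> by (auto simp: S_def)
    show "2 \<le> card {c \<in> C. v \<in> S c}" if "v \<in> V" for v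
    proof -
      obtain a b where ab: "(v, a) \<in> C" "(b, v) \<in> C" using \<open>v \<in> V\<close> C(1,2) by blast
      \<comment> \<open>If the two pairs coincided, they would be the loop \<open>(v, v)\<close>,
        which \<open>C\<close> excludes.\<close>
      then have "(v, a) \<noteq> (b, v)" using C(3) by blast
      then have "2 = card {(v, a), (b, v)}" by simp
      also have "\<dots> \<le> card {c \<in> C. v \<in> S c}"
        using ab finC by (intro card_mono) (auto simp: S_def)
      finally show ?thesis .
    qed
  qed (simp add: f_def)
  also have "\<dots> \<le> (\<Prod>c\<in>C. sqrt (2 * m))"
  proof (rule prod_mono, intro conjI)
    fix c assume "c \<in> C"
    obtain u v where c: "c = (u, v)" by fastforce
    then have "u \<noteq> v" using \<open>c \<in> C\<close> C(3) by blast
    let ?Q = "{p \<in> PiE (S c) (\<lambda>_. verts G). (p u, p v) \<in> adjacency G}"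
    \<comment> \<open>A member of \<open>?Q\<close> is determined by its values at the two ends,
      which form an ordered edge of \<open>G\<close>.\<close>
    have "inj_on (\<lambda>p. (p u, p v)) ?Q"
    proof (rule inj_onI)
      fix p q assume "p \<in> ?Q" "q \<in> ?Q" and eq: "(p u, p v) = (q u, q v)"
      then have "p \<in> PiE (S c) (\<lambda>_. verts G)" "q \<in> PiE (S c) (\<lambda>_. verts G)" by simp_all
      then show "p = q" by (rule PiE_ext) (use eq c in \<open>auto simp: S_def\<close>)
    qed
    then have "card ?Q \<le> card (adjacency G)"
      by (rule card_inj_on_le) (auto simp: card_adjacency_le[OF G(1)] simp del: adjacency_iff)
    then have "card ?Q \<le> 2 * m" using card_adjacency_le(2)[OF G(1)] by (simp add: m_def)
    moreover have "(\<Sum>p\<in>PiE (S c) (\<lambda>_. verts G). (f c p)\<^sup>2) = real (card ?Q)"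
      using finG by (simp add: f_def c S_def finite_PiE Int_def of_bool_def if_distrib[of "\<lambda>x. x\<^sup>2"] del: adjacency_iff flip: sum.inter_filter cong: if_cong)
    ultimately show "L2_set (f c) (PiE (S c) (\<lambda>_. verts G)) \<le> sqrt (2 * m)"
      unfolding L2_set_def by simp
  qed simp
  also have "\<dots> = (2 * real m) powr (real (card C) / 2)"
    using \<open>0 < m\<close> by (simp add: powr_half_sqrt[symmetric] powr_power)
  finally show ?thesis by (simp add: m_def)
qed

section \<open>Automorphisms and labelled copies\<close>

lemma card_Aut_pos:
  assumes "simple_graph H"
  shows "finite (Aut H)" "0 < card (Aut H)"
proof -
  show fin: "finite (Aut H)"
    using finite_permutations[of "verts H"] assms
    by (rule_tac finite_subset) (auto simp: Aut_def simple_graph_def)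
  have "id \<in> Aut H" by (auto simp: Aut_def graph_iso_def permutes_id)
  then show "0 < card (Aut H)" using fin by (auto simp: card_gt_0_iff)
qed

text \<open>Fix one isomorphism per copy \<open>S\<close>. Its inverse, composed with the
  automorphisms of \<open>H\<close>, yields \<open>card (Aut H)\<close> different homomorphisms with
  image \<open>S\<close>.\<close>

lemma induced_copies_times_card_Aut_le:
  fixes G :: "'b ugraph" and H :: "'a ugraph"
  assumes G: "simple_graph G" and H: "simple_graph H"
  shows "induced_copies G H * card (Aut H)
    \<le> card {h \<in> PiE (verts H) (\<lambda>_. verts G). \<forall>(u, v)\<in>adjacency H. (h u, h v) \<in> adjacency G}"
    (is "_ \<le> card ?Hom")
proof -
  let ?V = "verts H"
  define \<S> where "\<S> = {S. S \<subseteq> verts G \<and> isomorphic (induced_subgraph G S) H}"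
  have "\<forall>S\<in>\<S>. \<exists>\<phi>. graph_iso \<phi> (induced_subgraph G S) H"
    by (auto simp: \<S>_def isomorphic_def)
  then obtain \<phi> where \<phi>: "\<And>S. S \<in> \<S> \<Longrightarrow> graph_iso (\<phi> S) (induced_subgraph G S) H" by metis
  define g where "g = (\<lambda>S. inv_into S (\<phi> S))"
  have bij: "bij_betw (\<phi> S) S ?V" if "S \<in> \<S>" for S
    using \<phi>[OF that] by (simp add: graph_iso_def induced_subgraph_def)
  then have g: "bij_betw (g S) ?V S" if "S \<in> \<S>" for S
    using that by (simp add: g_def bij_betw_inv_into)
  have \<phi>g: "\<phi> S (g S v) = v" if "S \<in> \<S>" "v \<in> ?V" for S v
    using bij[OF that(1)] that(2) by (simp add: g_def bij_betw_inv_into_right)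
  define F where "F = (\<lambda>(S, a). restrict (\<lambda>v. g S (a v)) ?V)"
  have aut: "a permutes ?V" "\<And>u v. u \<in> ?V \<Longrightarrow> v \<in> ?V \<Longrightarrow> {u, v} \<in> edges H \<Longrightarrow> {a u, a v} \<in> edges H"
    if "a \<in> Aut H" for a using that by (auto simp: Aut_def graph_iso_def)
  have img: "F (S, a) ` ?V = S" if "S \<in> \<S>" "a \<in> Aut H" for S a
  proof -
    have "F (S, a) ` ?V = g S ` (a ` ?V)" by (auto simp: F_def)
    then show ?thesis using permutes_image[OF aut(1)[OF that(2)]] g[OF that(1)]
      by (simp add: bij_betw_def)
  qed
  have Hom: "F (S, a) \<in> ?Hom" if *: "S \<in> \<S>" "a \<in> Aut H" for S a
  proof -
    have SG: "S \<subseteq> verts G" using *(1) by (simp add: \<S>_def)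
    have av: "a v \<in> ?V" if "v \<in> ?V" for v using aut(1)[OF *(2)] that by (simp add: permutes_in_image)
    have gv: "g S v \<in> S" if "v \<in> ?V" for v using g[OF *(1)] that by (auto simp: bij_betw_def)
    have "{g S (a u), g S (a v)} \<in> edges G" if "{u, v} \<in> edges H" for u v
    proof -
      have uv: "u \<in> ?V" "v \<in> ?V" using simple_graph_edgeD[OF H that] by blast+
      then have "{\<phi> S (g S (a u)), \<phi> S (g S (a v))} \<in> edges H"
        using aut(2)[OF *(2) uv that] \<phi>g[OF *(1)] av by simp
      then show ?thesis using \<phi>[OF *(1)] gv[OF av[OF uv(1)]] gv[OF av[OF uv(2)]]
        by (auto simp: graph_iso_def induced_subgraph_def)
    qed
    moreover have "F (S, a) \<in> PiE ?V (\<lambda>_. verts G)"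
      using gv av SG by (auto simp: F_def)
    ultimately show "F (S, a) \<in> ?Hom"
      using simple_graph_edgeD[OF H] by (auto simp: F_def)
  qed
  \<comment> \<open>The image of the map returns \<open>S\<close>; then \<open>\<phi> S\<close>
    returns the automorphism on the vertices, and off them every automorphism is the identity by
    \<open>permutes\<close>.\<close>
  have "inj_on F (\<S> \<times> Aut H)"
  proof (rule inj_onI, clarify)
    fix S a T b assume *: "S \<in> \<S>" "a \<in> Aut H" "T \<in> \<S>" "b \<in> Aut H" "F (S, a) = F (T, b)"
    then have "S = T" using img by metis
    have "a v = b v" for v
    proof (cases "v \<in> ?V")
      case True
      then have "g S (a v) = g S (b v)" "a v \<in> ?V" "b v \<in> ?V"
        using fun_cong[OF *(5), of v] \<open>S = T\<close> aut(1)[OF *(2)] aut(1)[OF *(4)]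
        by (auto simp: F_def permutes_in_image)
      then show ?thesis using \<phi>g[OF *(1)] by metis
    next
      case False
      then show ?thesis using aut(1)[OF *(2)] aut(1)[OF *(4)] by (simp add: permutes_not_in)
    qed
    then show "S = T \<and> a = b" using \<open>S = T\<close> by auto
  qed
  moreover have "F ` (\<S> \<times> Aut H) \<subseteq> ?Hom" by (rule image_subsetI) (use Hom in \<open>simp only: mem_Times_iff split_paired_all fst_conv snd_conv\<close>)
  moreover have "finite ?Hom"
    using G H by (intro finite_subset[OF _ finite_PiE[of ?V "\<lambda>_. verts G"]]) (auto simp: simple_graph_def)
  ultimately have "card (\<S> \<times> Aut H) \<le> card ?Hom" by (rule card_inj_on_le)
  then show ?thesis by (simp add: induced_copies_def \<S>_def card_cartesian_product)
qed

text \<open>Homomorphisms are relaxed to maps that respect only the pairs in \<open>C\<close>; this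
  suffices because \<open>card C / 2\<close> is at most the fractional independence number.\<close>

lemma induced_copies_upper_bound:
  fixes G :: "'b ugraph" and H :: "'a ugraph"
  assumes G: "simple_graph G" "edges G \<noteq> {}" and H: "simple_graph H" "no_isolated_vertices H"
  shows "real (induced_copies G H)
    \<le> (2 * real (card (edges G))) powr fractional_independence_number H / real (card (Aut H))"
proof -
  obtain C where C: "C \<subseteq> adjacency H" "Domain C = verts H" "Range C = verts H"
    "real (card C) \<le> 2 * fractional_independence_number H"
    using fractional_independence_number_cover[OF H] by metis
  have fV: "finite (verts H)" "finite (verts G)" using G H by (auto simp: simple_graph_def)
  have m: "1 \<le> real (card (edges G))"
    using G simple_graph_finite_edges[OF G(1)] by (simp add: Suc_le_eq card_gt_0_iff)
  let ?Hom = "\<lambda>R. {h \<in> PiE (verts H) (\<lambda>_. verts G). \<forall>(u, v)\<in>R. (h u, h v) \<in> adjacency G}"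
  have "real (induced_copies G H * card (Aut H)) \<le> real (card (?Hom (adjacency H)))"
    using induced_copies_times_card_Aut_le[OF G(1) H(1)] by (simp only: of_nat_le_iff)
  also have "\<dots> \<le> real (card (?Hom C))"
    using C(1) fV by (intro of_nat_mono card_mono finite_subset[OF _ finite_PiE[of "verts H" "\<lambda>_. verts G"]]) auto
  also have "\<dots> \<le> (2 * real (card (edges G))) powr (real (card C) / 2)"
  proof (rule card_cover_homomorphisms_le[OF G fV(1) C(2,3)])
    show "u \<noteq> v" if "(u, v) \<in> C" for u v
      using simple_graph_edgeD(3)[OF H(1)] C(1) that by (metis adjacency_iff subsetD)
  qed
  also have "\<dots> \<le> (2 * real (card (edges G))) powr fractional_independence_number H"
    using C(4) m by (intro powr_mono) auto
  finally show ?thesis using card_Aut_pos[OF H(1)] by (simp add: field_simps)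
qed

section \<open>Host graphs and the lower bound\<close>

text \<open>An induced embedding carries copies to copies and distinct vertex sets to distinct
  images. This moves a host to another vertex type or into a larger host.\<close>

lemma induced_copies_mono_embedding:
  fixes G :: "'b ugraph" and G' :: "'c ugraph" and H :: "'a ugraph"
  assumes inj: "inj_on \<iota> (verts G)" and sub: "\<iota> ` verts G \<subseteq> verts G'" and fin: "finite (verts G')"
    and E: "\<And>u v. u \<in> verts G \<Longrightarrow> v \<in> verts G \<Longrightarrow> {\<iota> u, \<iota> v} \<in> edges G' \<longleftrightarrow> {u, v} \<in> edges G"
  shows "induced_copies G H \<le> induced_copies G' H"
  unfolding induced_copies_def
proof (rule card_inj_on_le)
  show "inj_on (image \<iota>) {S. S \<subseteq> verts G \<and> isomorphic (induced_subgraph G S) H}"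
    by (rule inj_on_subset[OF inj_on_image_Pow[OF inj]]) auto
  show "finite {S. S \<subseteq> verts G' \<and> isomorphic (induced_subgraph G' S) H}"
    using fin by (intro finite_subset[OF _ finite_Pow_iff[THEN iffD2, OF fin]]) auto
  show "image \<iota> ` {S. S \<subseteq> verts G \<and> isomorphic (induced_subgraph G S) H}
    \<subseteq> {S. S \<subseteq> verts G' \<and> isomorphic (induced_subgraph G' S) H}"
  proof clarify
    fix S assume S: "S \<subseteq> verts G" "isomorphic (induced_subgraph G S) H"
    then obtain f where f: "bij_betw f S (verts H)"
      "\<And>u v. u \<in> S \<Longrightarrow> v \<in> S \<Longrightarrow> {u, v} \<in> edges G \<longleftrightarrow> {f u, f v} \<in> edges H"
      by (auto simp: isomorphic_def graph_iso_def induced_subgraph_def)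
    let ?f = "f \<circ> inv_into S \<iota>"
    have injS: "inj_on \<iota> S" using inj S(1) by (rule inj_on_subset)
    have inv: "inv_into S \<iota> (\<iota> u) = u" if "u \<in> S" for u using injS that by simp
    have "bij_betw ?f (\<iota> ` S) (verts H)"
      using f(1) injS by (intro bij_betw_trans[of _ _ S] bij_betw_inv_into) (auto simp: bij_betw_def)
    moreover have "{\<iota> u, \<iota> v} \<in> edges G' \<longleftrightarrow> {?f (\<iota> u), ?f (\<iota> v)} \<in> edges H" if "u \<in> S" "v \<in> S" for u v
      using that S(1) E f(2) inv by (simp add: subset_iff)
    ultimately have "graph_iso ?f (induced_subgraph G' (\<iota> ` S)) H"
      unfolding graph_iso_def induced_subgraph_def by (simp add: image_iff)
    then show "\<iota> ` S \<subseteq> verts G' \<and> isomorphic (induced_subgraph G' (\<iota> ` S)) H"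
      using S(1) sub by (auto simp: isomorphic_def)
  qed
qed

text \<open>\<open>rho\<close> admits only hosts on \<open>nat\<close> with exactly \<open>m\<close>
  edges; any host with at most \<open>m\<close> edges is brought into that form without losing
  copies.\<close>

lemma extend_to_nat_graph:
  fixes G :: "'b ugraph" and H :: "'a ugraph"
  assumes G: "simple_graph G" "card (edges G) \<le> m"
  obtains G' :: "nat ugraph" where "simple_graph G'" "card (edges G') = m"
    "induced_copies G H \<le> induced_copies G' H"
proof -
  let ?V = "verts G"
  define N where "N = card ?V"
  have fV: "finite ?V" using G by (simp add: simple_graph_def)
  then obtain \<iota> where bij: "bij_betw \<iota> ?V {..<N}"
    unfolding N_def by (metis ex_bij_betw_finite_nat atLeast0LessThan)
  then have inj: "inj_on \<iota> ?V" and img: "\<iota> ` ?V = {..<N}" by (auto simp: bij_betw_def)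
  have sub: "e \<subseteq> ?V" "card e = 2" if "e \<in> edges G" for e using G(1) that by (auto simp: simple_graph_def)
  \<comment> \<open>The missing edges form a star on fresh vertices, which destroys no induced copy.\<close>
  define star where "star = (\<lambda>j. {N, N + 1 + j}) ` {..<m - card (edges G)}"
  define E where "E = image \<iota> ` edges G"
  \<comment> \<open>The centre of the star is \<open>N\<close> and its leaves lie between
    \<open>N + 1\<close> and \<open>N + m\<close>; some of these vertices may stay isolated.\<close>
  define G' where "G' = \<lparr>verts = {..N + m}, edges = E \<union> star\<rparr>"
  have "inj_on (\<lambda>j. {N, N + 1 + j}) {..<m - card (edges G)}"
    by (auto simp: inj_on_def doubleton_eq_iff)
  then have cstar: "card star = m - card (edges G)" by (simp add: star_def card_image)
  have injE: "inj_on (image \<iota>) (edges G)"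
    using inj_on_image_Pow[OF inj] by (rule inj_on_subset) (use sub in auto)
  have Esub: "e \<subseteq> {..<N} \<and> card e = 2" if e: "e \<in> E" for e
  proof -
    from e obtain d where d: "d \<in> edges G" "e = \<iota> ` d" by (auto simp: E_def)
    have "card e = card d" unfolding d by (rule card_image) (use inj sub[OF d(1)] inj_on_subset in blast)
    then show ?thesis using d sub[OF d(1)] img by auto
  qed
  have "E \<inter> star = {}" using Esub by (fastforce simp: star_def)
  moreover have "finite E" "finite star" using simple_graph_finite_edges[OF G(1)] by (auto simp: E_def star_def)
  ultimately have "card (edges G') = m"
    using G(2) cstar injE by (simp add: G'_def card_Un_disjoint E_def card_image)
  moreover have "simple_graph G'"
    using Esub by (fastforce simp: simple_graph_def G'_def star_def)
  moreover have "induced_copies G H \<le> induced_copies G' H"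
  proof (rule induced_copies_mono_embedding[OF inj])
    fix u v assume uv: "u \<in> ?V" "v \<in> ?V"
    then have "\<iota> u < N" "\<iota> v < N" using img by auto
    \<comment> \<open>Every edge of the star contains \<open>N\<close>, which is not the image of a
      vertex.\<close>
    then have "{\<iota> u, \<iota> v} \<notin> star" by (auto simp: star_def doubleton_eq_iff)
    moreover have "\<iota> ` {u, v} \<in> image \<iota> ` edges G \<longleftrightarrow> {u, v} \<in> edges G"
      by (rule inj_on_image_mem_iff[OF inj_on_image_Pow[OF inj]]) (use uv sub in auto)
    ultimately show "{\<iota> u, \<iota> v} \<in> edges G' \<longleftrightarrow> {u, v} \<in> edges G"
      by (simp add: G'_def E_def)
  qed (use img in \<open>auto simp: G'_def\<close>)
  ultimately show thesis using that by blast
qed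

section \<open>The maximum over hosts with \<open>m\<close> edges\<close>

context
  fixes H :: "'a ugraph" and m :: nat
  assumes H: "simple_graph H" "no_isolated_vertices H" and m: "0 < m"
begin

text \<open>There are infinitely many hosts, but the upper bound depends on \<open>m\<close> and
  \<open>H\<close> alone, so only finitely many counts occur.\<close>

lemma finite_induced_copies_counts:
  "finite {induced_copies G H | G :: nat ugraph. simple_graph G \<and> card (edges G) = m}"
proof (rule finite_subset)
  let ?b = "(2 * real m) powr fractional_independence_number H / real (card (Aut H))"
  show "{induced_copies G H | G :: nat ugraph. simple_graph G \<and> card (edges G) = m} \<subseteq> {..nat \<lfloor>?b\<rfloor>}"
  proof
    fix c assume "c \<in> {induced_copies G H | G :: nat ugraph. simple_graph G \<and> card (edges G) = m}"
    then obtain G :: "nat ugraph" where G: "simple_graph G" "card (edges G) = m" "c = induced_copies G H"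
      by blast
    then have "edges G \<noteq> {}" using m by auto
    from induced_copies_upper_bound[OF G(1) this H] G show "c \<in> {..nat \<lfloor>?b\<rfloor>}"
      by (simp add: le_nat_floor)
  qed
qed simp

lemma induced_copies_le_rho:
  fixes G :: "'b ugraph"
  assumes "simple_graph G" "card (edges G) \<le> m"
  shows "induced_copies G H \<le> rho H m"
proof -
  obtain G' :: "nat ugraph" where G': "simple_graph G'" "card (edges G') = m"
    "induced_copies G H \<le> induced_copies G' H"
    using extend_to_nat_graph[OF assms] by blast
  note G'(3)
  also have "induced_copies G' H \<le> rho H m"
    unfolding rho_def by (rule Max_ge[OF finite_induced_copies_counts]) (use G' in blast)
  finally show ?thesis .
qed

lemma rho_upper_bound:
  "real (rho H m) \<le> (2 * real m) powr fractional_independence_number H / real (card (Aut H))"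
proof -
  \<comment> \<open>A single vertex, padded to \<open>m\<close> edges, shows that the set of counts
    is nonempty, so some host attains the maximum.\<close>
  have "simple_graph \<lparr>verts = {0::nat}, edges = {}\<rparr>" by (simp add: simple_graph_def)
  then obtain G0 :: "nat ugraph" where "simple_graph G0" "card (edges G0) = m"
    by (rule extend_to_nat_graph[of _ m]) simp
  then have "{induced_copies G H | G :: nat ugraph. simple_graph G \<and> card (edges G) = m} \<noteq> {}" by blast
  from Max_in[OF finite_induced_copies_counts this]
  obtain G :: "nat ugraph" where G: "simple_graph G" "card (edges G) = m" "rho H m = induced_copies G H"
    unfolding rho_def by blast
  then have "edges G \<noteq> {}" using m by auto
  from induced_copies_upper_bound[OF G(1) this H] G show ?thesis by simp
qed

end

section \<open>Blow-ups and their transversals\<close>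

text \<open>Tagging each new vertex with its origin makes \<open>fst\<close> the projection to
  \<open>H\<close>. For simple \<open>H\<close> every class is independent: two of its vertices
  project to a singleton, which is no edge.\<close>

definition blowup :: "'a ugraph \<Rightarrow> ('a \<Rightarrow> nat) \<Rightarrow> ('a \<times> nat) ugraph" where
  "blowup H k = \<lparr>verts = (SIGMA v:verts H. {..<k v}),
     edges = {{p, q} | p q. p \<in> (SIGMA v:verts H. {..<k v}) \<and> q \<in> (SIGMA v:verts H. {..<k v})
       \<and> {fst p, fst q} \<in> edges H}\<rparr>"

lemma blowup_edge_iff:
  "{p, q} \<in> edges (blowup H k) \<longleftrightarrow>
    p \<in> verts (blowup H k) \<and> q \<in> verts (blowup H k) \<and> {fst p, fst q} \<in> edges H"
proof -
  \<comment> \<open>The ends of an edge may be listed in either order, but the projected pair is the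
    same.\<close>
  have *: "{fst p, fst q} = {fst p', fst q'}" if "{p, q} = {p', q'}" for p' q' :: "'a \<times> nat"
    using that by (metis image_empty image_insert)
  show ?thesis
  proof
    assume "{p, q} \<in> edges (blowup H k)"
    then obtain p' q' where pq: "{p, q} = {p', q'}" "p' \<in> verts (blowup H k)" "q' \<in> verts (blowup H k)"
      "{fst p', fst q'} \<in> edges H" by (auto simp: blowup_def)
    then have "p \<in> {p', q'}" "q \<in> {p', q'}" by blast+
    with pq *[OF pq(1)] show "p \<in> verts (blowup H k) \<and> q \<in> verts (blowup H k) \<and> {fst p, fst q} \<in> edges H"
      by auto
  next
    assume "p \<in> verts (blowup H k) \<and> q \<in> verts (blowup H k) \<and> {fst p, fst q} \<in> edges H"
    then show "{p, q} \<in> edges (blowup H k)" unfolding blowup_def ugraph.simps by blast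
  qed
qed

lemma simple_graph_blowup:
  assumes "simple_graph H" "\<And>v. v \<in> verts H \<Longrightarrow> 0 < k v"
  shows "simple_graph (blowup H k)"
proof -
  obtain v where "v \<in> verts H" using assms(1) by (auto simp: simple_graph_def)
  then have "(v, 0) \<in> verts (blowup H k)" using assms(2) by (simp add: blowup_def)
  moreover have "finite (verts (blowup H k))" using assms(1) by (auto simp: simple_graph_def blowup_def)
  moreover have "e \<subseteq> verts (blowup H k) \<and> card e = 2" if e: "e \<in> edges (blowup H k)" for e
  proof -
    from e obtain p q where pq: "e = {p, q}" by (auto simp: blowup_def)
    with e have "p \<in> verts (blowup H k)" "q \<in> verts (blowup H k)" "{fst p, fst q} \<in> edges H"
      by (simp_all add: blowup_edge_iff)
    moreover from this have "p \<noteq> q" using simple_graph_edgeD(3)[OF assms(1)] by blast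
    ultimately show ?thesis by (simp add: pq)
  qed
  ultimately show ?thesis unfolding simple_graph_def by blast
qed

text \<open>Edges are grouped by their projection: at most \<open>k u * k v\<close> of them lie
  above \<open>{u, v}\<close>.\<close>

lemma card_edges_blowup_le:
  assumes H: "simple_graph H"
    and n: "\<And>u v. {u, v} \<in> edges H \<Longrightarrow> real (k u * k v) \<le> n"
  shows "real (card (edges (blowup H k))) \<le> real (card (edges H)) * n"
proof -
  define F where "F = (\<lambda>e. {{p, q} | p q. p \<in> verts (blowup H k) \<and> q \<in> verts (blowup H k) \<and> {fst p, fst q} = e})"
  have F: "real (card (F e)) \<le> n \<and> finite (F e)" if e: "e \<in> edges H" for e
  proof -
    obtain u v where uv: "e = {u, v}" using edge_obtain[OF H e] by blast
    have *: "F e \<subseteq> (\<lambda>(i, j). {(u, i), (v, j)}) ` ({..<k u} \<times> {..<k v})"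
    proof
      fix x assume "x \<in> F e"
      then obtain a i b j where x: "x = {(a, i), (b, j)}" "i < k a" "j < k b" "{a, b} = {u, v}"
        by (auto simp: F_def blowup_def uv)
      then consider "a = u" "b = v" | "a = v" "b = u" by (auto simp: doubleton_eq_iff)
      then show "x \<in> (\<lambda>(i, j). {(u, i), (v, j)}) ` ({..<k u} \<times> {..<k v})"
      proof cases
        case 1
        then show ?thesis using x by (intro image_eqI[of _ _ "(i, j)"]) auto
      next
        case 2
        then show ?thesis using x by (intro image_eqI[of _ _ "(j, i)"]) auto
      qed
    qed
    have "card (F e) \<le> card ({..<k u} \<times> {..<k v})"
      by (rule order_trans[OF card_mono[OF _ *] card_image_le]) auto
    then have "real (card (F e)) \<le> real (k u * k v)" by (simp only: card_cartesian_product card_lessThan of_nat_le_iff)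
    then show ?thesis using n[of u v] e uv finite_subset[OF *] by auto
  qed
  have fE: "finite (edges H)" by (rule simple_graph_finite_edges[OF H])
  have "edges (blowup H k) = (\<Union>e\<in>edges H. F e)"
    unfolding F_def blowup_def ugraph.simps by blast
  then have "real (card (edges (blowup H k))) \<le> (\<Sum>e\<in>edges H. real (card (F e)))"
    using card_UN_le[OF fE, of F] by (simp flip: of_nat_sum)
  also have "\<dots> \<le> real (card (edges H)) * n" using F by (intro sum_bounded_above) auto
  finally show ?thesis .
qed

text \<open>One vertex from each class spans a copy, with \<open>fst\<close> as isomorphism, and
  different choices give different vertex sets.\<close>

lemma induced_copies_blowup_ge:
  assumes H: "simple_graph H"
  shows "(\<Prod>v\<in>verts H. k v) \<le> induced_copies (blowup H k) H"
proof -
  let ?V = "verts H" and ?B = "blowup H k"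
  have fV: "finite ?V" using H by (simp add: simple_graph_def)
  have fB: "finite (verts ?B)" using fV by (simp add: blowup_def)
  define T where "T = (\<lambda>t :: 'a \<Rightarrow> nat. (\<lambda>v. (v, t v)) ` ?V)"
  have "card (PiE ?V (\<lambda>v. {..<k v})) \<le> induced_copies ?B H"
    unfolding induced_copies_def
  proof (rule card_inj_on_le)
    show "inj_on T (PiE ?V (\<lambda>v. {..<k v}))"
    proof (rule inj_onI)
      fix s t assume *: "s \<in> PiE ?V (\<lambda>v. {..<k v})" "t \<in> PiE ?V (\<lambda>v. {..<k v})" "T s = T t"
      show "s = t"
      proof (rule PiE_ext[OF *(1,2)])
        fix v assume "v \<in> ?V"
        then have "(v, s v) \<in> T t" using *(3) by (auto simp: T_def)
        then show "s v = t v" by (auto simp: T_def)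
      qed
    qed
    show "finite {S. S \<subseteq> verts ?B \<and> isomorphic (induced_subgraph ?B S) H}"
      using fB by (intro finite_subset[OF _ finite_Pow_iff[THEN iffD2, OF fB]]) auto
    show "T ` PiE ?V (\<lambda>v. {..<k v}) \<subseteq> {S. S \<subseteq> verts ?B \<and> isomorphic (induced_subgraph ?B S) H}"
    proof clarify
      fix t assume "t \<in> PiE ?V (\<lambda>v. {..<k v})"
      then have sub: "T t \<subseteq> verts ?B" by (auto simp: T_def blowup_def PiE_iff)
      have "bij_betw fst (T t) ?V"
        by (auto simp: bij_betw_def inj_on_def T_def image_image)
      moreover have "{p, q} \<in> edges ?B \<longleftrightarrow> {fst p, fst q} \<in> edges H" if "p \<in> T t" "q \<in> T t" for p q
        using that sub by (auto simp: blowup_edge_iff)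
      ultimately have "graph_iso fst (induced_subgraph ?B (T t)) H"
        by (auto simp: graph_iso_def induced_subgraph_def)
      then show "T t \<subseteq> verts ?B \<and> isomorphic (induced_subgraph ?B (T t)) H"
        using sub by (auto simp: isomorphic_def)
    qed
  qed
  then show ?thesis using fV by (simp add: card_PiE)
qed

text \<open>The factors are the class sizes of a blow-up. Over each edge of \<open>H\<close> their
  product is at most \<open>n = m / card (edges H)\<close>, so the blow-up has at most
  \<open>m\<close> edges.\<close>

lemma rho_lower_bound:
  assumes H: "simple_graph H" "no_isolated_vertices H" and m: "0 < m" "card (edges H) \<le> m"
    and w: "fractional_independent H w"
  shows "(\<Prod>v\<in>verts H. real (nat \<lfloor>(real m / real (card (edges H))) powr w v\<rfloor>)) \<le> real (rho H m)"
proof -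
  define n where "n = real m / real (card (edges H))"
  have E: "0 < card (edges H)" by (rule card_edges_pos[OF H])
  then have n1: "1 \<le> n" using m by (simp add: n_def)
  define k where "k = (\<lambda>v. nat \<lfloor>n powr w v\<rfloor>)"
  have kle: "real (k v) \<le> n powr w v" for v
    unfolding k_def by (simp add: of_nat_floor)
  \<comment> \<open>As \<open>1 \<le> n\<close> and the weights are nonnegative, rounding down
    leaves no class empty.\<close>
  have kpos: "0 < k v" if "v \<in> verts H" for v
  proof -
    have "1 \<le> n powr w v" using n1 w that by (simp add: fractional_independent_def ge_one_powr_ge_zero)
    then show ?thesis by (simp add: k_def)
  qed
  have "real (k u * k v) \<le> n" if uv: "{u, v} \<in> edges H" for u v
  proof -
    have "real (k u * k v) \<le> n powr w u * n powr w v"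
      unfolding of_nat_mult by (intro mult_mono kle) auto
    also have "\<dots> = n powr (w u + w v)" by (simp add: powr_add)
    also have "\<dots> \<le> n powr 1"
      using n1 w uv simple_graph_edgeD[OF H(1) uv] by (intro powr_mono) (auto simp: fractional_independent_def)
    finally show ?thesis using n1 by simp
  qed
  from card_edges_blowup_le[OF H(1) this] have "card (edges (blowup H k)) \<le> m"
    using E by (simp add: n_def)
  then have "induced_copies (blowup H k) H \<le> rho H m"
    by (intro induced_copies_le_rho H m simple_graph_blowup kpos)
  then have "(\<Prod>v\<in>verts H. k v) \<le> rho H m"
    using induced_copies_blowup_ge[OF H(1), of k] by linarith
  then show ?thesis unfolding k_def n_def by (metis of_nat_le_iff of_nat_prod)
qed

text \<open>Rounding down loses at most 1, which is negligible against \<open>x\<close>; rounding a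
  growing class size thus costs only a factor tending to 1.\<close>

lemma tendsto_nat_floor_over_self:
  "((\<lambda>x :: real. real (nat \<lfloor>x\<rfloor>) / x) \<longlongrightarrow> 1) at_top"
proof (rule tendsto_sandwich)
  show "eventually (\<lambda>x :: real. 1 - 1 / x \<le> real (nat \<lfloor>x\<rfloor>) / x) at_top"
    using eventually_gt_at_top[of 0]
  proof eventually_elim
    case (elim x)
    have "x - 1 \<le> real (nat \<lfloor>x\<rfloor>)" using elim by linarith
    then have "(x - 1) / x \<le> real (nat \<lfloor>x\<rfloor>) / x" using elim
      by (simp only: divide_right_mono less_imp_le)
    then show ?case using elim by (simp add: diff_divide_distrib)
  qed
  show "eventually (\<lambda>x :: real. real (nat \<lfloor>x\<rfloor>) / x \<le> 1) at_top"
    using eventually_gt_at_top[of 0] by eventually_elim (simp add: of_nat_floor)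
  show "((\<lambda>x :: real. 1 - 1 / x) \<longlongrightarrow> 1) at_top"
    using tendsto_diff[OF tendsto_const[of 1] tendsto_inverse_0_at_top[OF filterlim_ident]]
    by (simp add: inverse_eq_divide)
qed simp

theorem theorem1p3:
  fixes H :: "'a ugraph"
  assumes "simple_graph H" and "no_isolated_vertices H"
  shows "(\<exists>\<epsilon> :: nat \<Rightarrow> real. \<epsilon> \<longlonglongrightarrow> 0 \<and>
            (\<forall>m>0. (1 - \<epsilon> m) * (real m / real (card (edges H))) powr fractional_independence_number H
                    \<le> real (rho H m))) \<and>
         (\<forall>m>0. real (rho H m)
                  \<le> (2 * real m) powr fractional_independence_number H / real (card (Aut H)))"
proof (intro conjI allI impI)
  show "real (rho H m) \<le> (2 * real m) powr fractional_independence_number H / real (card (Aut H))"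
    if "0 < m" for m using rho_upper_bound[OF assms that] .
  obtain w where w: "fractional_independent H w" "(\<Sum>v\<in>verts H. w v) = fractional_independence_number H"
    using fractional_independence_number_cover[OF assms] by metis
  have E: "0 < card (edges H)" by (rule card_edges_pos[OF assms])
  have fV: "finite (verts H)" using assms by (simp add: simple_graph_def)
  define n where "n = (\<lambda>m. real m / real (card (edges H)))"
  define \<alpha> where "\<alpha> = fractional_independence_number H"
  \<comment> \<open>\<open>P m\<close> is the factor that survives rounding; since the weights sum
    to \<open>\<alpha>\<close>, its denominators multiply to \<open>n m powr \<alpha>\<close> for
    positive \<open>n m\<close>.\<close>
  define P where "P = (\<lambda>m. \<Prod>v\<in>verts H. real (nat \<lfloor>n m powr w v\<rfloor>) / n m powr w v)"
  \<comment> \<open>The relative shortfall of \<open>rho\<close>, cut off at 0. The inequality then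
    holds for every positive \<open>m\<close> by construction, and only the limit needs an
    argument.\<close>
  define \<epsilon> where "\<epsilon> = (\<lambda>m. max 0 (1 - real (rho H m) / n m powr \<alpha>))"
  have n_top: "filterlim n at_top sequentially"
    unfolding n_def divide_inverse using E
    by (intro filterlim_at_top_mult_tendsto_pos[OF tendsto_const] filterlim_real_sequentially) auto
  have "(\<lambda>m. real (nat \<lfloor>n m powr w v\<rfloor>) / n m powr w v) \<longlonglongrightarrow> 1" if "v \<in> verts H" for v
  proof (cases "w v = 0")
    \<comment> \<open>A class of weight 0 does not grow: its size is 1 as soon as \<open>n m\<close>
      is positive, so the ratio is eventually constant.\<close>
    case True
    have "eventually (\<lambda>m. 0 < n m) sequentially"
      using n_top by (simp add: filterlim_at_top_dense)
    then have "eventually (\<lambda>m. real (nat \<lfloor>n m powr w v\<rfloor>) / n m powr w v = 1) sequentially"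
      by eventually_elim (simp add: True)
    then show ?thesis by (rule tendsto_eventually)
  next
    case False
    then have "0 < w v" using w(1) that by (simp add: fractional_independent_def less_le)
    from real_powr_at_top[OF this] have "filterlim (\<lambda>m. n m powr w v) at_top sequentially"
      using n_top by (rule filterlim_compose)
    then show ?thesis by (rule filterlim_compose[OF tendsto_nat_floor_over_self])
  qed
  then have "P \<longlonglongrightarrow> (\<Prod>v\<in>verts H. 1)" unfolding P_def by (intro tendsto_prod)
  then have lim: "(\<lambda>m. max 0 (1 - P m)) \<longlonglongrightarrow> 0"
    by (auto intro!: tendsto_eq_intros)
  have "\<epsilon> \<longlonglongrightarrow> 0"
  proof (rule tendsto_sandwich[OF _ _ tendsto_const lim])
    \<comment> \<open>The blow-up bound requires \<open>card (edges H) \<le> m\<close>, so the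
      comparison with \<open>P\<close> is made only for large \<open>m\<close>.\<close>
    show "eventually (\<lambda>m. \<epsilon> m \<le> max 0 (1 - P m)) sequentially"
      using eventually_ge_at_top[of "card (edges H)"]
    proof eventually_elim
      case (elim m)
      then have npos: "0 < n m" using E by (simp add: n_def)
      have "P m = (\<Prod>v\<in>verts H. real (nat \<lfloor>n m powr w v\<rfloor>)) / n m powr \<alpha>"
        using npos fV by (simp add: P_def prod_dividef powr_sum \<alpha>_def flip: w(2))
      also have "\<dots> \<le> real (rho H m) / n m powr \<alpha>"
        using rho_lower_bound[OF assms _ elim w(1)] E elim by (intro divide_right_mono) (auto simp: n_def)
      finally show ?case by (simp add: \<epsilon>_def)
    qed
  qed (simp add: \<epsilon>_def)
  moreover have "(1 - \<epsilon> m) * n m powr \<alpha> \<le> real (rho H m)" if "0 < m" for m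
  proof -
    have "0 < n m powr \<alpha>" using that E by (simp add: n_def)
    moreover have "1 - \<epsilon> m \<le> real (rho H m) / n m powr \<alpha>" by (simp add: \<epsilon>_def)
    ultimately show ?thesis by (simp add: pos_le_divide_eq)
  qed
  ultimately show "\<exists>\<epsilon> :: nat \<Rightarrow> real. \<epsilon> \<longlonglongrightarrow> 0 \<and>
            (\<forall>m>0. (1 - \<epsilon> m) * (real m / real (card (edges H))) powr fractional_independence_number H
                    \<le> real (rho H m))"
    unfolding n_def \<alpha>_def by blast
qed

end
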